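(* Let $S_1=\mathrm{lin}\{(1,0)^T\}$, $S_2=\mathrm{lin}\{(0,1)^T\}$, $\mathcal{S}=\{S_1,S_2\}$, and let $\alpha\in\mathbb{N}$. Then there exist two instances $\mathcal{I}_1,\mathcal{I}_2$ of the double-resolution problem DR and finite sets $F_1,F_2\subset\mathbb{Z}^2$ with the following properties: (i) $F_1$ is the unique solution of $\mathcal{I}_1$; (ii) $F_2$ is the unique solution of $\mathcal{I}_2$; (iii) $\Delta_{\mathcal{S}}(F_1,F_2)=4$; (iv) $|F_1|=|F_2|\ge\alpha$; (v) $|F_1\cap F_2|=\tfrac12|F_1|$.
   Context: For a finite set $F\subset\mathbb{Z}^2$ and a $1$-dimensional linear subspace $S$ of $\mathbb{R}^2$, the discrete X-ray $X_S F$ is the function on the set of affine lines $T$ parallel to $S$ given by $(X_S F)(T)=|F\cap T|$. For finite $F_1,F_2\subset\mathbb{Z}^2$ and a finite set $\mathcal{S}$ of such subspaces, the X-ray difference is $\Delta_{\mathcal{S}}(F_1,F_2)=\sum_{S\in\mathcal{S}}\|X_S F_1 - X_S F_2\|_1$, where $\|g\|_1=\sum_T |g(T)|$. The double-resolution problem DR: let $n_1,n_2$ be even positive integers and $B=\{0,\dots,n_1-1\}\times\{0,\dots,n_2-1\}$. An instance consists of a low-resolution gray-level image $\rho:\{0,\dots,n_1/2-1\}\times\{0,\dots,n_2/2-1\}\to\{0,1,2,3,4\}$ together with data functions $f_{S_1}, f_{S_2}$ (prescribed values on lines parallel to $S_1$ resp. $S_2$). A solution is a set $F\subset B$ (equivalently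 a binary image $\psi:B\to\{0,1\}$) such that $X_{S_1}F=f_{S_1}$, $X_{S_2}F=f_{S_2}$, and for every low-resolution pixel $y=(y_1,y_2)$ the $2\times 2$ block constraint $|F\cap(\{2y_1,2y_1+1\}\times\{2y_2,2y_2+1\})|=\rho(y)$ holds. An instance has a unique solution if it has exactly one solution. *)

theory Defs
  imports "HOL-Analysis.Analysis"
begin

definition lattice_embed :: "int \<times> int \<Rightarrow> real \<times> real" where
  "lattice_embed z = (real_of_int (fst z), real_of_int (snd z))"

definition lines_parallel :: "(real \<times> real) set \<Rightarrow> (real \<times> real) set set" where
  "lines_parallel S = {(+) p ` S |p. p \<in> UNIV}"

definition xray :: "(int \<times> int) set \<Rightarrow> (real \<times> real) set \<Rightarrow> nat" where
  "xray F T = card {z \<in> F. lattice_embed z \<in> T}"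

(* The lines parallel to S form an uncountable set, hence the infinite sum.  For finite
   F1, F2 only finitely many summands are nonzero, so the family is summable. *)
definition xray_dist ::
  "(real \<times> real) set \<Rightarrow> (int \<times> int) set \<Rightarrow> (int \<times> int) set \<Rightarrow> real" where
  "xray_dist S F1 F2 =
     (\<Sum>\<^sub>\<infinity>T\<in>lines_parallel S. \<bar>real (xray F1 T) - real (xray F2 T)\<bar>)"

definition xray_diff ::
  "(real \<times> real) set set \<Rightarrow> (int \<times> int) set \<Rightarrow> (int \<times> int) set \<Rightarrow> real" where
  "xray_diff \<S> F1 F2 = (\<Sum>S\<in>\<S>. xray_dist S F1 F2)"

(* HOL functions are total: the values of gray outside the low-resolution grid, and of
   data1, data2 outside the lines parallel to the respective direction, are irrelevant. *)
record dr_instance =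
  n1 :: int
  n2 :: int
  gray :: "int \<times> int \<Rightarrow> nat"
  data1 :: "(real \<times> real) set \<Rightarrow> nat"
  data2 :: "(real \<times> real) set \<Rightarrow> nat"

definition grid :: "dr_instance \<Rightarrow> (int \<times> int) set" where
  "grid I = {0..<n1 I} \<times> {0..<n2 I}"

definition low_res_grid :: "dr_instance \<Rightarrow> (int \<times> int) set" where
  "low_res_grid I = {0..<n1 I div 2} \<times> {0..<n2 I div 2}"

definition block :: "int \<times> int \<Rightarrow> (int \<times> int) set" where
  "block y = {2 * fst y, 2 * fst y + 1} \<times> {2 * snd y, 2 * snd y + 1}"

definition is_dr_instance :: "dr_instance \<Rightarrow> bool" where
  "is_dr_instance I \<longleftrightarrow>
     0 < n1 I \<and> even (n1 I) \<and> 0 < n2 I \<and> even (n2 I) \<and>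
     gray I \<in> low_res_grid I \<rightarrow> {0..4}"

definition is_solution ::
  "(real \<times> real) set \<Rightarrow> (real \<times> real) set \<Rightarrow> dr_instance \<Rightarrow> (int \<times> int) set \<Rightarrow> bool" where
  "is_solution S1 S2 I F \<longleftrightarrow>
     F \<subseteq> grid I \<and>
     (\<forall>T \<in> lines_parallel S1. xray F T = data1 I T) \<and>
     (\<forall>T \<in> lines_parallel S2. xray F T = data2 I T) \<and>
     (\<forall>y \<in> low_res_grid I. card (F \<inter> block y) = gray I y)"

definition is_unique_solution ::
  "(real \<times> real) set \<Rightarrow> (real \<times> real) set \<Rightarrow> dr_instance \<Rightarrow> (int \<times> int) set \<Rightarrow> bool" where
  "is_unique_solution S1 S2 I F \<longleftrightarrow>
     is_solution S1 S2 I F \<and> (\<forall>G. is_solution S1 S2 I G \<longrightarrow> G = F)"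

end

theory Submission
  imports Defs
begin

text \<open>
  A set of points with even coordinates meets every \<open>2 \<times> 2\<close> block in at most its lower left corner.
  The line sums say which lattice lines are empty, so any set with the same line sums again
  has only even coordinates and is then recovered from the block counts. Hence every such set
  is the unique solution of the instance it defines. It remains to choose three translates
  of a long diagonal, \<open>D\<^sub>0, D\<^sub>1, D\<^sub>2\<close>, shifted vertically by \<open>0, 2, 4\<close>: the sets \<open>D\<^sub>0 \<union> D\<^sub>1\<close> and
  \<open>D\<^sub>1 \<union> D\<^sub>2\<close> share \<open>D\<^sub>1\<close>, have the same vertical X-ray, and differ by one point on exactly
  four horizontal lines.
\<close>

section \<open>Lines parallel to the axes and their X-rays\<close>

lemma span_horizontal: "span {(1, 0) :: real \<times> real} = snd -` {0}"
  by (auto simp: span_singleton)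

lemma span_vertical: "span {(0, 1) :: real \<times> real} = fst -` {0}"
  by (auto simp: span_singleton)

text \<open>Viewing the lines as fibres of \<open>snd\<close> indexes them by height, which turns
  X-ray values into row counts.\<close>

lemma lines_parallel_horizontal:
  "lines_parallel (span {(1, 0)}) = range (\<lambda>c. snd -` {c})"
proof -
  have *: "(+) p ` (snd -` {0}) = snd -` {snd p}" for p :: "real \<times> real"
  proof (intro equalityI subsetI)
    fix z :: "real \<times> real" assume "z \<in> snd -` {snd p}"
    then show "z \<in> (+) p ` (snd -` {0})"
      by (intro image_eqI[of _ _ "z - p"]) auto
  qed auto
  show ?thesis
    unfolding lines_parallel_def span_horizontal * by force
qed

lemma lines_parallel_vertical:
  "lines_parallel (span {(0, 1)}) = range (\<lambda>c. fst -` {c})"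
proof -
  have *: "(+) p ` (fst -` {0}) = fst -` {fst p}" for p :: "real \<times> real"
  proof (intro equalityI subsetI)
    fix z :: "real \<times> real" assume "z \<in> fst -` {fst p}"
    then show "z \<in> (+) p ` (fst -` {0})"
      by (intro image_eqI[of _ _ "z - p"]) auto
  qed auto
  show ?thesis
    unfolding lines_parallel_def span_vertical * by force
qed

lemma snd_lattice_embed: "snd (lattice_embed z) = of_int (snd z)"
  and fst_lattice_embed: "fst (lattice_embed z) = of_int (fst z)"
  by (simp_all add: lattice_embed_def)

lemma xray_horizontal: "xray F (snd -` {of_int y}) = card {z \<in> F. snd z = y}"
  and xray_vertical: "xray F (fst -` {of_int x}) = card {z \<in> F. fst z = x}"
  by (simp_all add: xray_def snd_lattice_embed fst_lattice_embed)

lemma xray_Un_disjoint: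
  assumes "finite A" "finite B" "A \<inter> B = {}"
  shows "xray (A \<union> B) T = xray A T + xray B T"
proof -
  have "{z \<in> A \<union> B. lattice_embed z \<in> T} =
      {z \<in> A. lattice_embed z \<in> T} \<union> {z \<in> B. lattice_embed z \<in> T}"
    by auto
  then show ?thesis
    using assms by (auto simp: xray_def intro!: card_Un_disjoint)
qed

text \<open>The point \<open>z\<close> makes the sum of \<open>G\<close> along \<open>T\<close>
  positive, so \<open>F\<close> cannot miss \<open>T\<close>. This is how empty lines of
  \<open>F\<close> forbid points of \<open>G\<close>.\<close>

lemma xray_eq_imp_meets:
  assumes "finite G" "z \<in> G" "lattice_embed z \<in> T" "xray G T = xray F T"
  shows "\<exists>w\<in>F. lattice_embed w \<in> T"
proof -
  have "xray G T \<noteq> 0"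
    using assms(1-3) card_0_eq[of "{w \<in> G. lattice_embed w \<in> T}"] unfolding xray_def by fastforce
  then have "xray F T \<noteq> 0"
    using assms by simp
  then have "{w \<in> F. lattice_embed w \<in> T} \<noteq> {}"
    unfolding xray_def by (metis card.empty)
  then show ?thesis
    by blast
qed

text \<open>Only the rows with height in \<open>Y\<close> can carry points of either set, so the sum
  over uncountably many lines collapses to a finite one.\<close>

lemma xray_dist_horizontal:
  assumes Y: "finite Y" "snd ` F1 \<subseteq> Y" "snd ` F2 \<subseteq> Y"
  shows "xray_dist (span {(1, 0)}) F1 F2 =
    (\<Sum>y\<in>Y. \<bar>real (card {z \<in> F1. snd z = y}) - real (card {z \<in> F2. snd z = y})\<bar>)"
proof -
  let ?f = "\<lambda>T. \<bar>real (xray F1 T) - real (xray F2 T)\<bar>"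
  let ?h = "\<lambda>y::int. snd -` {real_of_int y} :: (real \<times> real) set"
  have zero: "xray F (snd -` {c}) = 0"
    if "snd ` F \<subseteq> Y" "snd -` {c} \<notin> ?h ` Y" for F and c :: real
  proof -
    have "{z \<in> F. lattice_embed z \<in> snd -` {c}} = {}"
      using that by (auto simp: snd_lattice_embed)
    then show ?thesis
      by (simp only: xray_def card.empty)
  qed
  \<comment> \<open>Distinct heights give distinct lines, so the sum over lines can be reindexed by
    height.\<close>
  have inj: "inj_on ?h Y"
  proof (rule inj_onI)
    fix a b assume eq: "?h a = ?h b"
    have "(0, real_of_int a) \<in> ?h a"
      by simp
    then show "a = b"
      unfolding eq by simp
  qed
  have "xray_dist (span {(1, 0)}) F1 F2 = infsum ?f (?h ` Y)"
    unfolding xray_dist_def lines_parallel_horizontal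
    by (rule infsum_cong_neutral) (use Y zero in \<open>auto simp del: vimage_eq\<close>)
  also have "\<dots> = (\<Sum>y\<in>Y. ?f (?h y))"
    using Y inj by (simp add: sum.reindex)
  finally show ?thesis
    by (simp add: xray_horizontal)
qed

section \<open>Uniqueness for sets of even points\<close>

definition even_points :: "(int \<times> int) set" where
  "even_points = {z. even (fst z) \<and> even (snd z)}"

text \<open>All data are read off \<open>F\<close>. As \<open>xray F\<close> takes the line itself
  as argument, it serves both directions.\<close>

definition instance_of :: "int \<Rightarrow> int \<Rightarrow> (int \<times> int) set \<Rightarrow> dr_instance" where
  "instance_of a b F = \<lparr>n1 = a, n2 = b, gray = \<lambda>y. card (F \<inter> block y), data1 = xray F, data2 = xray F\<rparr>"

lemma is_dr_instance_instance_of: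
  assumes "0 < a" "even a" "0 < b" "even b"
  shows "is_dr_instance (instance_of a b F)"
proof -
  have "card (F \<inter> block y) \<le> 4" for y
  proof -
    have "card (F \<inter> block y) \<le> card (block y)"
      by (rule card_mono) (auto simp: block_def)
    also have "\<dots> = 4"
      by (simp add: block_def card_cartesian_product)
    finally show ?thesis .
  qed
  then show ?thesis
    using assms by (auto simp: is_dr_instance_def instance_of_def)
qed

lemma even_points_Int_block:
  assumes "G \<subseteq> even_points"
  shows "G \<inter> block y = (if (2 * fst y, 2 * snd y) \<in> G then {(2 * fst y, 2 * snd y)} else {})"
  using assms by (auto simp: even_points_def block_def)

lemma even_points_unique_solution:
  assumes F: "F \<subseteq> even_points" "F \<subseteq> {0..<a} \<times> {0..<b}"
    and ab: "even a" "even b"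
  shows "is_unique_solution (span {(1, 0)}) (span {(0, 1)}) (instance_of a b F) F"
  unfolding is_unique_solution_def
proof (intro conjI allI impI)
  show "is_solution (span {(1, 0)}) (span {(0, 1)}) (instance_of a b F) F"
    using F by (simp add: is_solution_def instance_of_def grid_def)
next
  fix G assume "is_solution (span {(1, 0)}) (span {(0, 1)}) (instance_of a b F) G"
  then have G: "G \<subseteq> {0..<a} \<times> {0..<b}"
    and horizontal: "\<And>c. xray G (snd -` {c}) = xray F (snd -` {c})"
    and vertical: "\<And>c. xray G (fst -` {c}) = xray F (fst -` {c})"
    and gray: "\<And>y. y \<in> {0..<a div 2} \<times> {0..<b div 2} \<Longrightarrow> card (G \<inter> block y) = card (F \<inter> block y)"
    by (auto simp: is_solution_def instance_of_def grid_def low_res_grid_def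
        lines_parallel_horizontal lines_parallel_vertical)
  have "finite G"
    by (rule finite_subset[OF G]) simp
  \<comment> \<open>Each coordinate of a point of \<open>G\<close> is shared with a point of
    \<open>F\<close>: the second via its row, the first via its column.\<close>
  have even: "G \<subseteq> even_points"
  proof
    fix z assume z: "z \<in> G"
    obtain v where "v \<in> F" "snd v = snd z"
      using xray_eq_imp_meets[OF \<open>finite G\<close> z _ horizontal, of "of_int (snd z)"]
      by (auto simp: snd_lattice_embed)
    moreover obtain w where "w \<in> F" "fst w = fst z"
      using xray_eq_imp_meets[OF \<open>finite G\<close> z _ vertical, of "of_int (fst z)"]
      by (auto simp: fst_lattice_embed)
    ultimately show "z \<in> even_points"
      using F(1) by (force simp: even_points_def)
  qed
  show "G = F"
  proof (rule set_eqI)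
    fix z
    show "z \<in> G \<longleftrightarrow> z \<in> F"
    proof (cases "z \<in> even_points \<and> z \<in> {0..<a} \<times> {0..<b}")
      case True
      then obtain i j where z: "z = (2 * i, 2 * j)"
        by (auto simp: even_points_def elim!: evenE)
      \<comment> \<open>Evenness of \<open>a\<close> and \<open>b\<close> ensures that the block
        with corner \<open>z\<close> is a pixel of the low-resolution grid.\<close>
      have "(i, j) \<in> {0..<a div 2} \<times> {0..<b div 2}"
        using True z ab by (auto elim!: evenE)
      \<comment> \<open>Both block counts are 1 or 0 according to whether \<open>z\<close> belongs
        to the set.\<close>
      from gray[OF this] show ?thesis
        by (auto simp: z even_points_Int_block even F split: if_splits)
    next
      case False
      then show ?thesis
        using F G even by blast
    qed
  qed
qed

section \<open>Shifted diagonals and their X-ray differences\<close>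

text \<open>The parameter \<open>t\<close> is half the vertical shift, so
  \<open>diagonal m 0\<close>, \<open>diagonal m 1\<close>, \<open>diagonal m 2\<close> are the
  three diagonals described above.\<close>

definition diagonal :: "int \<Rightarrow> int \<Rightarrow> (int \<times> int) set" where
  "diagonal m t = (\<lambda>i. (2 * i, 2 * (i + t))) ` {0..<m}"

lemma finite_diagonal: "finite (diagonal m t)"
  by (simp add: diagonal_def)

lemma card_diagonal: "card (diagonal m t) = nat m"
  by (simp add: diagonal_def card_image inj_on_def)

lemma diagonal_disjoint: "s \<noteq> t \<Longrightarrow> diagonal m s \<inter> diagonal m t = {}"
  by (auto simp: diagonal_def)

lemma diagonal_subset_even_points: "diagonal m t \<subseteq> even_points"
  by (auto simp: diagonal_def even_points_def)

lemma diagonal_subset_grid: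
  assumes "0 \<le> t" "t \<le> r"
  shows "diagonal m t \<subseteq> {0..<2 * m} \<times> {0..<2 * (m + r)}"
  using assms by (auto simp: diagonal_def)

text \<open>A vertical shift keeps every point in its column; the count over indices
  \<open>i\<close> does not involve the shift.\<close>

lemma xray_diagonal_vertical: "xray (diagonal m s) (fst -` {c}) = xray (diagonal m t) (fst -` {c})"
proof -
  have "xray (diagonal m t) (fst -` {c}) = card {i \<in> {0..<m}. real_of_int (2 * i) = c}" for t
  proof -
    have "{z \<in> diagonal m t. lattice_embed z \<in> fst -` {c}} =
        (\<lambda>i. (2 * i, 2 * (i + t))) ` {i \<in> {0..<m}. real_of_int (2 * i) = c}"
      by (auto simp: diagonal_def fst_lattice_embed)
    then show ?thesis
      by (simp add: xray_def card_image inj_on_def)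
  qed
  then show ?thesis
    by simp
qed

lemma card_diagonal_row:
  "card {z \<in> diagonal m t. snd z = 2 * j} = (if j \<in> {t..<m + t} then 1 else 0)"
proof -
  have "{z \<in> diagonal m t. snd z = 2 * j} = (if j \<in> {t..<m + t} then {(2 * (j - t), 2 * j)} else {})"
    unfolding diagonal_def
  proof (auto, goal_cases)
    case 1
    then show ?case
      by (intro image_eqI[of _ _ "j - t"]) auto
  qed
  then show ?thesis
    by simp
qed

lemma xray_dist_diagonal_vertical:
  assumes "r \<noteq> s" "s \<noteq> t"
  shows "xray_dist (span {(0, 1)}) (diagonal m r \<union> diagonal m s) (diagonal m s \<union> diagonal m t) = 0"
proof -
  have "real (xray (diagonal m r \<union> diagonal m s) T) - real (xray (diagonal m s \<union> diagonal m t) T) = 0"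
    if "T \<in> lines_parallel (span {(0, 1)})" for T
    using that assms
    by (auto simp: lines_parallel_vertical xray_Un_disjoint finite_diagonal diagonal_disjoint
        xray_diagonal_vertical[of m r _ t])
  then show ?thesis
    unfolding xray_dist_def by (intro infsum_0) simp
qed

lemma xray_dist_diagonal_horizontal:
  assumes m: "2 \<le> m"
  shows "xray_dist (span {(1, 0)}) (diagonal m 0 \<union> diagonal m 1) (diagonal m 1 \<union> diagonal m 2) = 4"
    (is "xray_dist _ ?F1 ?F2 = _")
proof -
  let ?Y = "(*) 2 ` {0..<m + 2}"
  let ?d = "\<lambda>j. \<bar>real (card {z \<in> ?F1. snd z = 2 * j}) - real (card {z \<in> ?F2. snd z = 2 * j})\<bar>"
  have row: "card {z \<in> diagonal m s \<union> diagonal m t. snd z = 2 * j} =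
      card {z \<in> diagonal m s. snd z = 2 * j} + card {z \<in> diagonal m t. snd z = 2 * j}"
    if "s \<noteq> t" for s t j
    using that xray_Un_disjoint[OF finite_diagonal finite_diagonal diagonal_disjoint]
    by (metis xray_horizontal)
  \<comment> \<open>The common diagonal cancels, leaving the indicators of the rows of the two outer
    ones.\<close>
  have d: "?d j = \<bar>(if j \<in> {0..<m} then 1 else 0) - (if j \<in> {2..<m + 2} then 1 else 0)\<bar>" for j
    by (subst (1 2) row) (auto simp: card_diagonal_row)
  have "xray_dist (span {(1, 0)}) ?F1 ?F2 =
      (\<Sum>y\<in>?Y. \<bar>real (card {z \<in> ?F1. snd z = y}) - real (card {z \<in> ?F2. snd z = y})\<bar>)"
  proof (rule xray_dist_horizontal)
    have "snd ` diagonal m t \<subseteq> ?Y" if "0 \<le> t" "t \<le> 2" for t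
      unfolding diagonal_def image_image snd_conv
      by (rule image_subsetI, rule imageI) (use that in auto)
    then show "snd ` ?F1 \<subseteq> ?Y" "snd ` ?F2 \<subseteq> ?Y"
      by (simp_all add: image_Un)
  qed simp
  also have "\<dots> = (\<Sum>j\<in>{0..<m + 2}. ?d j)"
    by (subst sum.reindex) (auto simp: inj_on_def)
  \<comment> \<open>The indices lie in the symmetric difference of the intervals
    \<open>{0..<m}\<close> and \<open>{2..<m + 2}\<close>; by \<open>2 \<le> m\<close> they are four
    distinct ones.\<close>
  also have "\<dots> = (\<Sum>j\<in>{0, 1, m, m + 1}. 1)"
    by (rule sum.mono_neutral_cong_right) (use m in \<open>auto simp only: d, auto split: if_splits\<close>)
  also have "\<dots> = 4"
    using m by simp
  finally show ?thesis .
qed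

theorem theorem19:
  fixes S1 S2 :: "(real \<times> real) set" and \<S> :: "(real \<times> real) set set" and \<alpha> :: nat
  assumes "S1 = span {(1, 0)}" and "S2 = span {(0, 1)}" and "\<S> = {S1, S2}"
  shows "\<exists>I1 I2 F1 F2.
    is_dr_instance I1 \<and> is_dr_instance I2 \<and> finite F1 \<and> finite F2 \<and>
    is_unique_solution S1 S2 I1 F1 \<and>
    is_unique_solution S1 S2 I2 F2 \<and>
    xray_diff \<S> F1 F2 = 4 \<and>
    card F1 = card F2 \<and> \<alpha> \<le> card F1 \<and>
    real (card (F1 \<inter> F2)) = 1 / 2 * real (card F1)"
proof -
  \<comment> \<open>The summand \<alpha> makes the sets large enough, and the 2 secures
    \<open>2 \<le> m\<close> for the row count.\<close>
  define m where "m = int \<alpha> + 2"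
  define F1 where "F1 = diagonal m 0 \<union> diagonal m 1"
  define F2 where "F2 = diagonal m 1 \<union> diagonal m 2"
  \<comment> \<open>The extra height 4 makes room for the largest shift.\<close>
  let ?I = "instance_of (2 * m) (2 * (m + 2))"
  have "2 \<le> m"
    by (simp add: m_def)
  \<comment> \<open>The directions must differ for the sum over \<open>{S1, S2}\<close> to split
    into two terms.\<close>
  have "(0, 1) \<notin> span {(1, 0) :: real \<times> real}" "(0, 1) \<in> span {(0, 1) :: real \<times> real}"
    by (simp_all add: span_horizontal span_vertical)
  then have "S1 \<noteq> S2"
    using assms by metis
  have inst: "is_dr_instance (?I F)" for F
    using \<open>2 \<le> m\<close> by (intro is_dr_instance_instance_of) auto
  have "F1 \<subseteq> even_points" "F2 \<subseteq> even_points"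
    by (simp_all add: F1_def F2_def diagonal_subset_even_points)
  moreover have "F1 \<subseteq> {0..<2 * m} \<times> {0..<2 * (m + 2)}" "F2 \<subseteq> {0..<2 * m} \<times> {0..<2 * (m + 2)}"
    unfolding F1_def F2_def by (intro Un_least diagonal_subset_grid; simp)+
  ultimately have "is_unique_solution S1 S2 (?I F1) F1" "is_unique_solution S1 S2 (?I F2) F2"
    unfolding assms by (auto intro!: even_points_unique_solution)
  moreover have "xray_diff \<S> F1 F2 = 4"
    using \<open>S1 \<noteq> S2\<close> xray_dist_diagonal_horizontal[OF \<open>2 \<le> m\<close>] xray_dist_diagonal_vertical[of 0 1 2 m]
    by (simp add: xray_diff_def assms F1_def F2_def)
  moreover have "card F1 = 2 * nat m" "card F2 = 2 * nat m"
    by (simp_all add: F1_def F2_def card_Un_disjoint finite_diagonal diagonal_disjoint card_diagonal)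
  moreover have "F1 \<inter> F2 = diagonal m 1"
    using diagonal_disjoint[of 0 1 m] diagonal_disjoint[of 0 2 m] by (auto simp: F1_def F2_def)
  then have "card (F1 \<inter> F2) = nat m"
    by (simp add: card_diagonal)
  moreover have "\<alpha> \<le> 2 * nat m"
    by (simp add: m_def)
  moreover have "finite F1" "finite F2"
    by (simp_all add: F1_def F2_def finite_diagonal)
  ultimately show ?thesis
    using inst by (intro exI[of _ "?I F1"] exI[of _ "?I F2"] exI[of _ F1] exI[of _ F2]) simp
qed

end
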